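(* (Family $(1,-,1)$, Painlevé III($\tilde D_6$).) Let $\theta_0,\theta_\infty\in\mathbb{C}$, and let $p,q$ be holomorphic functions of $t$ on a connected open set $U\subset\mathbb{C}^*$ with $q$ avoiding $0$. Put $w=\frac12(-tq^2-\theta_\infty q+2p)$, $k=\frac{4w^2-t^2}{4q}$, $h=\frac{t^2q^4-\theta_\infty^2q^2-4ptq^2-2t\theta_0q+4p^2-t^2}{4q^2}$, $$A_0=\begin{pmatrix}w&k\\-q&-w\end{pmatrix},\quad A_1=\begin{pmatrix}\frac{\theta_\infty}2&h\\1&-\frac{\theta_\infty}2\end{pmatrix},\quad A_2=\begin{pmatrix}\frac t2&0\\0&-\frac t2\end{pmatrix},$$ $$B=z\begin{pmatrix}\frac12&0\\0&-\frac12\end{pmatrix}+\begin{pmatrix}q+\frac{\theta_\infty}{2t}&\frac ht\\\frac1t&-q-\frac{\theta_\infty}{2t}\end{pmatrix}+\frac1z\begin{pmatrix}-\frac wt&-\frac kt\\\frac qt&\frac wt\end{pmatrix}.$$ Then the operators $\frac{d}{dz}+\frac{1}{z^2}A_0+\frac1zA_1+A_2$ and $\frac{d}{dt}+B$ commute if and only if $$\frac{dq}{dt}=\frac{4p+q}{t},\qquad\frac{dp}{dt}=\frac{4p^2}{qt}+\frac pt+tq^3+q^2-\frac tq-\theta_0+q^2\theta_\infty .$$ This system is the Hamiltonian system $\frac{dq}{dt}=-q^2\frac{\partial H}{\partial p}$, $\frac{dp}{dt}=q^2\frac{\partial H}{\partial q}$ with $$H=-\frac{2p^2}{q^2t}-\frac{p}{qt}+q+\frac{q^2t}2+\frac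 t{2q^2}+\frac{\theta_0}q+q\theta_\infty,$$ and, with $p=\frac14(tq'-q)$, it is equivalent to $$q''=\frac{(q')^2}{q}-\frac{q'}t-\frac{4\theta_0}t+\frac{4(\theta_\infty+1)q^2}{t}+4q^3-\frac4q .$$
   Context: Operators act on vector-valued functions of $(z,t)$; $\frac{d}{dz},\frac{d}{dt}$ are the partial derivatives. Two operators $\frac{d}{dz}+A$ and $\frac{d}{dt}+B$ with matrix functions $A(z,t),B(z,t)$ commute iff $\frac{\partial A}{\partial t}=\frac{\partial B}{\partial z}+AB-BA$ identically in $z,t$. In the Hamiltonian equations $H=H(p,q,t)$ with partial derivatives in the independent variables $p,q,t$; $'$ denotes $\frac{d}{dt}$. (This commutation is the isomonodromy condition for the family of connections.) *)

theory Defs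
  imports "HOL-Complex_Analysis.Complex_Analysis"
begin

definition mat2 :: "complex \<Rightarrow> complex \<Rightarrow> complex \<Rightarrow> complex \<Rightarrow> complex^2^2" where
  "mat2 a b c d = vector [vector [a, b], vector [c, d]]"

definition smult_mat :: "complex \<Rightarrow> complex^2^2 \<Rightarrow> complex^2^2"  (infixr "\<cdot>\<^sub>M" 75) where
  "c \<cdot>\<^sub>M M = (\<chi> i j. c * M $ i $ j)"

text \<open>Holomorphy of a vector-valued function of two complex variables: every component is
  Frechet differentiable with a complex-linear derivative.\<close>

definition holomorphic2_on :: "(complex \<Rightarrow> complex \<Rightarrow> complex^2) \<Rightarrow> (complex \<times> complex) set \<Rightarrow> bool" where
  "holomorphic2_on Y W \<longleftrightarrow>
     (\<forall>x\<in>W. \<forall>i. \<exists>a b. ((\<lambda>(z, t). Y z t $ i) has_derivative (\<lambda>(u, v). a * u + b * v)) (at x))"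

definition op_dz ::
  "(complex \<Rightarrow> complex \<Rightarrow> complex^2^2) \<Rightarrow> (complex \<Rightarrow> complex \<Rightarrow> complex^2) \<Rightarrow> complex \<Rightarrow> complex \<Rightarrow> complex^2" where
  "op_dz A Y z t = (\<chi> i. deriv (\<lambda>x. Y x t $ i) z) + A z t *v Y z t"

definition op_dt ::
  "(complex \<Rightarrow> complex \<Rightarrow> complex^2^2) \<Rightarrow> (complex \<Rightarrow> complex \<Rightarrow> complex^2) \<Rightarrow> complex \<Rightarrow> complex \<Rightarrow> complex^2" where
  "op_dt B Y z t = (\<chi> i. deriv (\<lambda>s. Y z s $ i) t) + B z t *v Y z t"

text \<open>The operators act on local holomorphic functions, since flat sections are in general
  multivalued on the whole domain.\<close>

definition operators_commute_on ::
  "(complex \<times> complex) set \<Rightarrow> (complex \<Rightarrow> complex \<Rightarrow> complex^2^2) \<Rightarrow> (complex \<Rightarrow> complex \<Rightarrow> complex^2^2) \<Rightarrow> bool" where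
  "operators_commute_on D A B \<longleftrightarrow>
     (\<forall>W Y. open W \<and> W \<subseteq> D \<and> holomorphic2_on Y W \<longrightarrow>
        (\<forall>(z, t)\<in>W. op_dz A (op_dt B Y) z t = op_dt B (op_dz A Y) z t))"

text \<open>In the following definitions \<open>\<theta>0\<close>, \<open>\<theta>i\<close> stand for $\theta_0$, $\theta_\infty$, and
  \<open>p\<close>, \<open>q\<close>, \<open>t\<close> are independent complex variables unless given a function type.\<close>

definition PIII_w :: "complex \<Rightarrow> complex \<Rightarrow> complex \<Rightarrow> complex \<Rightarrow> complex" where
  "PIII_w \<theta>i p q t = (1/2) * (- t * q^2 - \<theta>i * q + 2 * p)"

definition PIII_k :: "complex \<Rightarrow> complex \<Rightarrow> complex \<Rightarrow> complex \<Rightarrow> complex" where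
  "PIII_k \<theta>i p q t = (4 * (PIII_w \<theta>i p q t)^2 - t^2) / (4 * q)"

definition PIII_h :: "complex \<Rightarrow> complex \<Rightarrow> complex \<Rightarrow> complex \<Rightarrow> complex \<Rightarrow> complex" where
  "PIII_h \<theta>0 \<theta>i p q t =
     (t^2 * q^4 - \<theta>i^2 * q^2 - 4 * p * t * q^2 - 2 * t * \<theta>0 * q + 4 * p^2 - t^2) / (4 * q^2)"

definition PIII_A0 :: "complex \<Rightarrow> complex \<Rightarrow> complex \<Rightarrow> complex \<Rightarrow> complex^2^2" where
  "PIII_A0 \<theta>i p q t = mat2 (PIII_w \<theta>i p q t) (PIII_k \<theta>i p q t)
                            (- q) (- PIII_w \<theta>i p q t)"

definition PIII_A1 :: "complex \<Rightarrow> complex \<Rightarrow> complex \<Rightarrow> complex \<Rightarrow> complex \<Rightarrow> complex^2^2" where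
  "PIII_A1 \<theta>0 \<theta>i p q t = mat2 (\<theta>i / 2) (PIII_h \<theta>0 \<theta>i p q t)
                               1 (- (\<theta>i / 2))"

definition PIII_A2 :: "complex \<Rightarrow> complex^2^2" where
  "PIII_A2 t = mat2 (t / 2) 0
                    0 (- (t / 2))"

definition PIII_A ::
  "complex \<Rightarrow> complex \<Rightarrow> (complex \<Rightarrow> complex) \<Rightarrow> (complex \<Rightarrow> complex) \<Rightarrow> complex \<Rightarrow> complex \<Rightarrow> complex^2^2" where
  "PIII_A \<theta>0 \<theta>i p q z t =
     (1 / z^2) \<cdot>\<^sub>M PIII_A0 \<theta>i (p t) (q t) t + (1 / z) \<cdot>\<^sub>M PIII_A1 \<theta>0 \<theta>i (p t) (q t) t + PIII_A2 t"

definition PIII_B ::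
  "complex \<Rightarrow> complex \<Rightarrow> (complex \<Rightarrow> complex) \<Rightarrow> (complex \<Rightarrow> complex) \<Rightarrow> complex \<Rightarrow> complex \<Rightarrow> complex^2^2" where
  "PIII_B \<theta>0 \<theta>i p q z t =
     z \<cdot>\<^sub>M mat2 (1/2) 0
              0 (- (1/2))
     + mat2 (q t + \<theta>i / (2 * t)) (PIII_h \<theta>0 \<theta>i (p t) (q t) t / t)
            (1 / t) (- q t - \<theta>i / (2 * t))
     + (1 / z) \<cdot>\<^sub>M mat2 (- (PIII_w \<theta>i (p t) (q t) t / t)) (- (PIII_k \<theta>i (p t) (q t) t / t))
                     (q t / t) (PIII_w \<theta>i (p t) (q t) t / t)"

definition PIII_rhs_q :: "complex \<Rightarrow> complex \<Rightarrow> complex \<Rightarrow> complex" where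
  "PIII_rhs_q p q t = (4 * p + q) / t"

definition PIII_rhs_p :: "complex \<Rightarrow> complex \<Rightarrow> complex \<Rightarrow> complex \<Rightarrow> complex \<Rightarrow> complex" where
  "PIII_rhs_p \<theta>0 \<theta>i p q t =
     4 * p^2 / (q * t) + p / t + t * q^3 + q^2 - t / q - \<theta>0 + q^2 * \<theta>i"

definition PIII_H :: "complex \<Rightarrow> complex \<Rightarrow> complex \<Rightarrow> complex \<Rightarrow> complex \<Rightarrow> complex" where
  "PIII_H \<theta>0 \<theta>i p q t =
     - (2 * p^2 / (q^2 * t)) - p / (q * t) + q + q^2 * t / 2 + t / (2 * q^2) + \<theta>0 / q + q * \<theta>i"

definition PIII_system_on ::
  "complex set \<Rightarrow> complex \<Rightarrow> complex \<Rightarrow> (complex \<Rightarrow> complex) \<Rightarrow> (complex \<Rightarrow> complex) \<Rightarrow> bool" where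
  "PIII_system_on U \<theta>0 \<theta>i p q \<longleftrightarrow>
     (\<forall>t\<in>U. deriv q t = PIII_rhs_q (p t) (q t) t \<and> deriv p t = PIII_rhs_p \<theta>0 \<theta>i (p t) (q t) t)"

definition PIII_hamiltonian_system_on ::
  "complex set \<Rightarrow> complex \<Rightarrow> complex \<Rightarrow> (complex \<Rightarrow> complex) \<Rightarrow> (complex \<Rightarrow> complex) \<Rightarrow> bool" where
  "PIII_hamiltonian_system_on U \<theta>0 \<theta>i p q \<longleftrightarrow>
     (\<forall>t\<in>U. deriv q t = - ((q t)^2) * deriv (\<lambda>x. PIII_H \<theta>0 \<theta>i x (q t) t) (p t)
          \<and> deriv p t = (q t)^2 * deriv (\<lambda>y. PIII_H \<theta>0 \<theta>i (p t) y t) (q t))"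

definition PIII_equation_on ::
  "complex set \<Rightarrow> complex \<Rightarrow> complex \<Rightarrow> (complex \<Rightarrow> complex) \<Rightarrow> bool" where
  "PIII_equation_on U \<theta>0 \<theta>i q \<longleftrightarrow>
     (\<forall>t\<in>U. deriv (deriv q) t =
        (deriv q t)^2 / q t - deriv q t / t - 4 * \<theta>0 / t + 4 * (\<theta>i + 1) * (q t)^2 / t
        + 4 * (q t)^3 - 4 / q t)"

end

theory Submission
  imports Defs
begin

text \<open>On functions holomorphic in both variables the mixed partial derivatives agree, so the commutator
  of the two operators is multiplication by the curvature matrix; applying it to constants shows
  that commutation is the zero-curvature equation. Its diagonal and lower-left entries give
  differential equations for $w$ and $q$, equivalent to the system for $p$ and $q$. The upper-right
  entry is then automatic: $k$ and $h$ are determined by $4qk = 4w^2 - t^2$ and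
  $2qh = 2k + 2\theta_\infty w - \theta_0 t$, and differentiating these relations along the flow gives exactly
  the equations required of $k$ and $h$.\<close>

no_notation fps_nth (infixl "$" 75)

section \<open>Equality of mixed partials for functions holomorphic in two variables\<close>

text \<open>This is the first-order Taylor remainder on the disc of radius \<open>r\<close>. Discs
  of radius \<open>r\<close> about its points stay inside the disc of radius \<open>2 * r\<close>,
  so Cauchy's inequality bounds the second derivative there. The bound sees \<open>f\<close> only
  through \<open>M\<close>, which is what makes it uniform over a family of functions.\<close>

lemma diff_quotient_bound:
  fixes f :: "complex \<Rightarrow> complex"
  assumes f: "f holomorphic_on S" "open S" and sub: "cball a (2 * r) \<subseteq> S" and "r > 0"
    and M: "\<And>x. x \<in> cball a (2 * r) \<Longrightarrow> norm (f x) \<le> M"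
    and h: "norm h \<le> r" "h \<noteq> 0"
  shows "norm ((f (a + h) - f a) / h - deriv f a) \<le> 2 * M / r\<^sup>2 * norm h"
proof -
  \<comment> \<open>The order is written \<open>Suc 1\<close> to match \<open>complex_Taylor\<close>
    at n = 1. That theorem divides by \<open>fact 1\<close>, so the constant
    \<open>2 * M / r\<^sup>2\<close> passes unchanged into the remainder.\<close>
  have bound2: "norm ((deriv ^^ Suc 1) f x) \<le> 2 * M / r\<^sup>2" if x: "x \<in> cball a r" for x
  proof -
    have *: "cball x r \<subseteq> cball a (2 * r)"
      using x by (subst cball_subset_cball_iff) (simp add: dist_commute)
    then have "cball x r \<subseteq> S" using sub by blast
    then have "norm ((deriv ^^ 2) f x) \<le> fact 2 * M / r ^ 2"
      using * M \<open>r > 0\<close> f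
      by (intro Cauchy_inequality holomorphic_on_subset[OF f(1)] holomorphic_on_imp_continuous_on)
         (auto simp: dist_norm)
    then show ?thesis by (simp add: numeral_2_eq_2)
  qed
  have "cball a r \<subseteq> cball a (2 * r)" using \<open>r > 0\<close> by (intro subset_cball) simp
  then have aS: "cball a r \<subseteq> S" using sub by blast
  have "norm ((deriv ^^ 0) f (a + h) - (\<Sum>i\<le>1. (deriv ^^ i) f a * (a + h - a) ^ i / fact i))
      \<le> 2 * M / r\<^sup>2 * norm (a + h - a) ^ Suc 1 / fact 1"
  proof (rule complex_Taylor[where S = "cball a r"])
    fix i x assume "x \<in> cball a r"
    then show "((deriv ^^ i) f has_field_derivative (deriv ^^ Suc i) f x) (at x within cball a r)"
      using aS f by (blast intro: has_field_derivative_at_within has_field_derivative_higher_deriv)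
  qed (use bound2 h \<open>r > 0\<close> in \<open>auto simp: dist_norm simp del: funpow.simps\<close>)
  then have *: "norm (f (a + h) - f a - deriv f a * h) \<le> 2 * M / r\<^sup>2 * norm h ^ 2"
    by (simp add: algebra_simps power2_eq_square)
  have "(f (a + h) - f a) / h - deriv f a = (f (a + h) - f a - deriv f a * h) / h"
    using h by (simp add: field_simps)
  then have "norm ((f (a + h) - f a) / h - deriv f a) = norm (f (a + h) - f a - deriv f a * h) / norm h"
    by (simp add: norm_divide)
  also have "\<dots> \<le> 2 * M / r\<^sup>2 * norm h ^ 2 / norm h"
    using * by (intro divide_right_mono) auto
  also have "\<dots> = 2 * M / r\<^sup>2 * norm h" by (simp add: power2_eq_square)
  finally show ?thesis .
qed

text \<open>Scalar counterpart of \<open>holomorphic2_on\<close>, so that the calculus can be done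
  one component at a time.\<close>

definition holomorphic_pair_on :: "(complex \<Rightarrow> complex \<Rightarrow> complex) \<Rightarrow> (complex \<times> complex) set \<Rightarrow> bool" where
  "holomorphic_pair_on F W \<longleftrightarrow>
     (\<forall>x\<in>W. \<exists>a b. ((\<lambda>(z, t). F z t) has_derivative (\<lambda>(u, v). a * u + b * v)) (at x))"

lemma holomorphic_pair_partials:
  assumes "holomorphic_pair_on F W" "(z, t) \<in> W"
  shows "((\<lambda>x. F x t) has_field_derivative deriv (\<lambda>x. F x t) z) (at z)"
    and "(F z has_field_derivative deriv (F z) t) (at t)"
proof -
  obtain a b where *: "((\<lambda>(z, t). F z t) has_derivative (\<lambda>(u, v). a * u + b * v)) (at (z, t))"
    using assms by (auto simp: holomorphic_pair_on_def)
  have "((\<lambda>x. (x, t)) has_derivative (\<lambda>h. (h, 0))) (at z)"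
    by (auto intro!: derivative_eq_intros)
  from diff_chain_at[OF this *] have "((\<lambda>x. F x t) has_field_derivative a) (at z)"
    by (simp add: has_field_derivative_def o_def)
  then show "((\<lambda>x. F x t) has_field_derivative deriv (\<lambda>x. F x t) z) (at z)"
    using DERIV_imp_deriv by force
  have "((\<lambda>x. (z, x)) has_derivative (\<lambda>h. (0, h))) (at t)"
    by (auto intro!: derivative_eq_intros)
  from diff_chain_at[OF this *] have "(F z has_field_derivative b) (at t)"
    by (simp add: has_field_derivative_def o_def)
  then show "(F z has_field_derivative deriv (F z) t) (at t)"
    using DERIV_imp_deriv by force
qed

lemma holomorphic_pair_continuous: "holomorphic_pair_on F W \<Longrightarrow> continuous_on W (\<lambda>(z, t). F z t)"
  by (intro continuous_at_imp_continuous_on) (auto simp: holomorphic_pair_on_def dest!: bspec has_derivative_continuous)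

text \<open>On a small disc the difference quotients in the second variable converge uniformly to
  the partial derivative, so Weierstrass' theorem lets them be differentiated in the first variable.\<close>

lemma holomorphic_pair_mixed_partials:
  assumes F: "holomorphic_pair_on F W" and "open W" and zt: "(z, t) \<in> W"
  obtains D where "((\<lambda>x. deriv (F x) t) has_field_derivative D) (at z)"
    and "((\<lambda>s. deriv (\<lambda>x. F x s) z) has_field_derivative D) (at t)"
proof -
  obtain A B where AB: "open A" "open B" "z \<in> A" "t \<in> B" "A \<times> B \<subseteq> W"
    using open_prod_elim[OF \<open>open W\<close> zt] by (metis mem_Sigma_iff)
  obtain r1 r2 where r12: "r1 > 0" "cball z r1 \<subseteq> A" "r2 > 0" "cball t r2 \<subseteq> B"
    using AB open_contains_cball by metis
  \<comment> \<open>Halving \<open>r2\<close> leaves room in the second variable for the doubled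
    disc required by \<open>diff_quotient_bound\<close>.\<close>
  define r where "r = min r1 (r2 / 2)"
  have r: "r > 0" "cball z r \<subseteq> A" "cball t (2 * r) \<subseteq> B"
    using r12 by (auto simp: r_def)
  have W: "(x, s) \<in> W" if "x \<in> A" "s \<in> B" for x s using AB that by blast
  have hz: "(\<lambda>x. F x s) holomorphic_on A" if "s \<in> B" for s
    using holomorphic_pair_partials(1)[OF F W] that by (meson AB(1) holomorphic_on_open)
  have ht: "F x holomorphic_on B" if "x \<in> A" for x
    using holomorphic_pair_partials(2)[OF F W] that by (meson AB(2) holomorphic_on_open)
  \<comment> \<open>Compactness yields one bound \<open>M\<close> for all slices \<open>F x\<close>,
    hence a rate of convergence that does not depend on \<open>x\<close>.\<close>
  have "compact ((\<lambda>(z, t). F z t) ` (cball z r \<times> cball t (2 * r)))"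
    using r AB by (intro compact_continuous_image compact_Times
        continuous_on_subset[OF holomorphic_pair_continuous[OF F]]) auto
  then obtain M where "\<forall>y \<in> (\<lambda>(z, t). F z t) ` (cball z r \<times> cball t (2 * r)). norm y \<le> M"
    using compact_imp_bounded bounded_iff by metis
  then have M: "norm (F x s) \<le> M" if "x \<in> cball z r" "s \<in> cball t (2 * r)" for x s
    using that by force
  have near: "\<forall>\<^sub>F h in at (0::complex). h \<noteq> 0 \<and> norm h < \<epsilon>" if "\<epsilon> > 0" for \<epsilon> :: real
    using that by (auto simp: eventually_at dist_norm)
  \<comment> \<open>\<open>?f' h\<close> is the derivative of \<open>?f h\<close> in the first
    variable. At the point \<open>z\<close>, its limit as \<open>h\<close> tends to 0 is the
    derivative at \<open>t\<close> of the partial derivative in the first variable.\<close>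
  let ?f = "\<lambda>h x. (F x (t + h) - F x t) / h"
  let ?f' = "\<lambda>h x. (deriv (\<lambda>x. F x (t + h)) x - deriv (\<lambda>x. F x t) x) / h"
  have cont: "\<forall>\<^sub>F h in at 0. continuous_on (cball z r) (?f h) \<and>
      (\<forall>w \<in> ball z r. (?f h has_field_derivative ?f' h w) (at w))"
    using near[OF r(1)]
  proof eventually_elim
    case (elim h)
    then have "t + h \<in> B" "t \<in> B" using r AB by (auto simp: subset_eq dist_norm)
    moreover have "ball z r \<subseteq> A" using r(2) ball_subset_cball by blast
    ultimately show ?case using hz r(2) elim AB(1)
      by (intro conjI ballI continuous_intros derivative_intros DERIV_cdivide holomorphic_derivI
          continuous_on_subset[OF holomorphic_on_imp_continuous_on]) auto
  qed
  have ulim: "uniform_limit (cball z r) ?f (\<lambda>x. deriv (F x) t) (at 0)"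
  proof (rule uniform_limitI)
    fix e :: real assume "e > 0"
    define c where "c = 2 * M / r\<^sup>2"
    have "M \<ge> 0" using M[of z t] r by (auto intro: order_trans[OF norm_ge_zero])
    then have c: "c \<ge> 0" by (simp add: c_def)
    \<comment> \<open>Dividing by \<open>c + 1\<close> instead of \<open>c\<close> covers the case
      \<open>c = 0\<close>.\<close>
    have "\<forall>\<^sub>F h in at (0::complex). h \<noteq> 0 \<and> norm h < min r (e / (c + 1))"
      using r \<open>e > 0\<close> c by (intro near) auto
    then show "\<forall>\<^sub>F h in at 0. \<forall>x\<in>cball z r. dist (?f h x) (deriv (F x) t) < e"
    proof (eventually_elim, intro ballI)
      fix h :: complex and x
      assume h: "h \<noteq> 0 \<and> norm h < min r (e / (c + 1))" and x: "x \<in> cball z r"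
      have "dist (?f h x) (deriv (F x) t) \<le> c * norm h"
        unfolding dist_norm c_def using r x h M ht AB
        by (intro diff_quotient_bound[where S = B]) auto
      also have "\<dots> \<le> (c + 1) * norm h" by (simp add: algebra_simps)
      also have "\<dots> < e" using h c by (simp add: field_simps)
      finally show "dist (?f h x) (deriv (F x) t) < e" .
    qed
  qed
  obtain g' where g': "\<And>w. w \<in> ball z r \<Longrightarrow> ((\<lambda>x. deriv (F x) t) has_field_derivative g' w) (at w)
      \<and> ((\<lambda>h. ?f' h w) \<longlongrightarrow> g' w) (at 0)"
    using has_complex_derivative_uniform_limit[OF cont ulim _ r(1)] by auto
  \<comment> \<open>The same number \<open>g' z\<close> is the derivative of the limit function and
    the limit of the derivatives, so it is the mixed partial in either order.\<close>
  from g'[of z] r(1) show thesis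
    by (intro that[of "g' z"]) (auto simp: DERIV_def)
qed

section \<open>Commutator of the two operators and zero curvature\<close>

lemma holomorphic2_on_iff:
  "holomorphic2_on Y W \<longleftrightarrow> (\<forall>i. holomorphic_pair_on (\<lambda>z t. Y z t $ i) W)"
  unfolding holomorphic2_on_def holomorphic_pair_on_def by blast

text \<open>Both compositions contain the common mixed partial \<open>D i\<close> and both
  first-order terms, \<open>A\<close> applied to the t-derivative of \<open>Y\<close> and
  \<open>B\<close> applied to its z-derivative. These cancel, leaving no derivative of
  \<open>Y\<close>.\<close>

lemma op_commutator:
  assumes Y: "holomorphic2_on Y W" and "open W" and zt: "(z, t) \<in> W"
    and At: "\<And>i j. ((\<lambda>s. A z s $ i $ j) has_field_derivative A' $ i $ j) (at t)"
    and Bz: "\<And>i j. ((\<lambda>x. B x t $ i $ j) has_field_derivative B' $ i $ j) (at z)"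
  shows "op_dz A (op_dt B Y) z t - op_dt B (op_dz A Y) z t
       = (B' + A z t ** B z t - A' - B z t ** A z t) *v Y z t"
proof -
  have Yi: "holomorphic_pair_on (\<lambda>z t. Y z t $ i) W" for i
    using Y holomorphic2_on_iff by blast
  note Yz = holomorphic_pair_partials(1)[OF Yi zt] and Yt = holomorphic_pair_partials(2)[OF Yi zt]
  have "\<exists>D. ((\<lambda>x. deriv (\<lambda>s. Y x s $ i) t) has_field_derivative D) (at z) \<and>
            ((\<lambda>s. deriv (\<lambda>x. Y x s $ i) z) has_field_derivative D) (at t)" for i
    using holomorphic_pair_mixed_partials[OF Yi \<open>open W\<close> zt] by metis
  then obtain D where D: "\<And>i. ((\<lambda>x. deriv (\<lambda>s. Y x s $ i) t) has_field_derivative D i) (at z)"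
      "\<And>i. ((\<lambda>s. deriv (\<lambda>x. Y x s $ i) z) has_field_derivative D i) (at t)"
    by metis
  let ?dz = "\<lambda>j. deriv (\<lambda>x. Y x t $ j) z" and ?dt = "\<lambda>j. deriv (\<lambda>s. Y z s $ j) t"
  have "((\<lambda>x. op_dt B Y x t $ i) has_field_derivative
      D i + (\<Sum>j\<in>UNIV. B' $ i $ j * Y z t $ j + ?dz j * B z t $ i $ j)) (at z)" for i
    unfolding op_dt_def matrix_vector_mult_def vector_add_component vec_lambda_beta
    by (intro DERIV_add D DERIV_sum DERIV_mult Bz Yz)
  moreover have "((\<lambda>s. op_dz A Y z s $ i) has_field_derivative
      D i + (\<Sum>j\<in>UNIV. A' $ i $ j * Y z t $ j + ?dt j * A z t $ i $ j)) (at t)" for i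
    unfolding op_dz_def matrix_vector_mult_def vector_add_component vec_lambda_beta
    by (intro DERIV_add D DERIV_sum DERIV_mult At Yt)
  ultimately have *: "deriv (\<lambda>x. op_dt B Y x t $ i) z =
      D i + (\<Sum>j\<in>UNIV. B' $ i $ j * Y z t $ j + ?dz j * B z t $ i $ j)"
    "deriv (\<lambda>s. op_dz A Y z s $ i) t =
      D i + (\<Sum>j\<in>UNIV. A' $ i $ j * Y z t $ j + ?dt j * A z t $ i $ j)" for i
    by (simp_all add: DERIV_imp_deriv)
  show ?thesis
    unfolding vec_eq_iff
  proof
    fix i
    have "op_dz A (op_dt B Y) z t $ i - op_dt B (op_dz A Y) z t $ i =
      (D i + (\<Sum>j\<in>UNIV. B' $ i $ j * Y z t $ j + ?dz j * B z t $ i $ j)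
         + (A z t *v op_dt B Y z t) $ i)
      - (D i + (\<Sum>j\<in>UNIV. A' $ i $ j * Y z t $ j + ?dt j * A z t $ i $ j)
         + (B z t *v op_dz A Y z t) $ i)"
      unfolding op_dz_def[of A "op_dt B Y"] op_dt_def[of B "op_dz A Y"] by (simp add: *)
    then show "(op_dz A (op_dt B Y) z t - op_dt B (op_dz A Y) z t) $ i
      = ((B' + A z t ** B z t - A' - B z t ** A z t) *v Y z t) $ i"
      by (simp add: op_dz_def[of A Y] op_dt_def[of B Y] matrix_vector_mult_def matrix_matrix_mult_def
          sum_2 algebra_simps)
  qed
qed

lemma operators_commute_on_iff_zero_curvature:
  assumes "open D"
    and At: "\<And>z t i j. (z, t) \<in> D \<Longrightarrow> ((\<lambda>s. A z s $ i $ j) has_field_derivative A' z t $ i $ j) (at t)"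
    and Bz: "\<And>z t i j. (z, t) \<in> D \<Longrightarrow> ((\<lambda>x. B x t $ i $ j) has_field_derivative B' z t $ i $ j) (at z)"
  shows "operators_commute_on D A B \<longleftrightarrow>
    (\<forall>(z, t) \<in> D. A' z t = B' z t + A z t ** B z t - B z t ** A z t)"
proof
  assume comm: "operators_commute_on D A B"
  have "B' z t + A z t ** B z t - A' z t - B z t ** A z t = 0" if zt: "(z, t) \<in> D" for z t
  \<comment> \<open>A matrix that kills every vector is zero. Each vector is tested as a constant
    function, which is holomorphic on all of \<open>D\<close> with both derivative coefficients
    0.\<close>
  proof (subst matrix_eq, rule allI)
    fix v :: "complex^2"
    have const: "holomorphic2_on (\<lambda>_ _. v) D"
      unfolding holomorphic2_on_def by (auto intro!: exI[of _ 0] simp: case_prod_unfold)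
    then have "op_dz A (op_dt B (\<lambda>_ _. v)) z t = op_dt B (op_dz A (\<lambda>_ _. v)) z t"
      using comm zt \<open>open D\<close> unfolding operators_commute_on_def by blast
    then show "(B' z t + A z t ** B z t - A' z t - B z t ** A z t) *v v = 0 *v v"
      using op_commutator[of _ _ _ _ A "A' z t" B "B' z t", OF const \<open>open D\<close> zt At[OF zt] Bz[OF zt]] by simp
  qed
  then show "\<forall>(z, t) \<in> D. A' z t = B' z t + A z t ** B z t - B z t ** A z t"
    by (auto simp: algebra_simps)
next
  assume flat: "\<forall>(z, t) \<in> D. A' z t = B' z t + A z t ** B z t - B z t ** A z t"
  have "op_dz A (op_dt B Y) z t = op_dt B (op_dz A Y) z t"
    if "open W" "W \<subseteq> D" "holomorphic2_on Y W" "(z, t) \<in> W" for W Y z t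
  proof -
    have zt: "(z, t) \<in> D" using that by blast
    have "B' z t + A z t ** B z t - A' z t - B z t ** A z t = 0"
      using flat zt by auto
    then show ?thesis
      using op_commutator[of _ _ _ _ A "A' z t" B "B' z t", OF that(3,1,4) At[OF zt] Bz[OF zt]] by simp
  qed
  then show "operators_commute_on D A B"
    unfolding operators_commute_on_def by blast
qed

section \<open>Explicit 2 by 2 form of the zero-curvature equation\<close>

lemma mat2_nth [simp]:
  "mat2 a b c d $ 1 $ 1 = a" "mat2 a b c d $ 1 $ 2 = b"
  "mat2 a b c d $ 2 $ 1 = c" "mat2 a b c d $ 2 $ 2 = d"
  by (simp_all add: mat2_def)

lemma mat2_add: "mat2 a b c d + mat2 a' b' c' d' = mat2 (a + a') (b + b') (c + c') (d + d')"
  by (simp add: vec_eq_iff forall_2)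

lemma smult_mat2: "x \<cdot>\<^sub>M mat2 a b c d = mat2 (x * a) (x * b) (x * c) (x * d)"
  by (simp add: vec_eq_iff forall_2 smult_mat_def)

lemma mat2_eq_iff: "mat2 a b c d = mat2 a' b' c' d' \<longleftrightarrow> a = a' \<and> b = b' \<and> c = c' \<and> d = d'"
  by (auto simp: vec_eq_iff forall_2)

text \<open>Both connection matrices are traceless, and so is the commutator. The two diagonal
  entries therefore give the same condition, and three scalar equations remain.\<close>

lemma mat2_commutator:
  "mat2 a b c (- a) ** mat2 x y v (- x) - mat2 x y v (- x) ** mat2 a b c (- a) =
   mat2 (b * v - c * y) (2 * (a * y - b * x)) (2 * (c * x - a * v)) (- (b * v - c * y))"
  by (simp add: vec_eq_iff forall_2 matrix_matrix_mult_def sum_2 algebra_simps)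

text \<open>The lower-right entry is kept as a literal negation of the upper-left one, so that
  \<open>mat2_commutator\<close> applies by rewriting.\<close>

lemma PIII_A_eq:
  "PIII_A \<theta>0 \<theta>i p q z t =
     (let w = PIII_w \<theta>i (p t) (q t) t; k = PIII_k \<theta>i (p t) (q t) t; h = PIII_h \<theta>0 \<theta>i (p t) (q t) t
      in mat2 (w / z\<^sup>2 + \<theta>i / (2 * z) + t / 2) (k / z\<^sup>2 + h / z)
              (- q t / z\<^sup>2 + 1 / z) (- (w / z\<^sup>2 + \<theta>i / (2 * z) + t / 2)))"
  by (simp add: PIII_A_def PIII_A0_def PIII_A1_def PIII_A2_def smult_mat2 mat2_add Let_def mat2_eq_iff)

lemma PIII_B_eq:
  "PIII_B \<theta>0 \<theta>i p q z t =
     (let w = PIII_w \<theta>i (p t) (q t) t; k = PIII_k \<theta>i (p t) (q t) t; h = PIII_h \<theta>0 \<theta>i (p t) (q t) t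
      in mat2 (z / 2 + q t + \<theta>i / (2 * t) - w / t / z) (h / t - k / t / z)
              (1 / t + q t / t / z) (- (z / 2 + q t + \<theta>i / (2 * t) - w / t / z)))"
  by (simp add: PIII_B_def smult_mat2 mat2_add Let_def mat2_eq_iff)

text \<open>The primed scalars stand for the t-derivatives of the coefficients; \<open>A'\<close> is
  the t-derivative of \<open>A\<close> and \<open>B'\<close> the z-derivative of \<open>B\<close>.
  In the diagonal and lower-left entries only one negative power of \<open>z\<close> survives and
  cancels. The upper-right entry keeps two powers, which can stay together because that entry is
  later deduced from the others.\<close>

lemma zero_curvature_mat2_iff:
  fixes z t w k h q \<theta> w' k' h' q' :: complex
  assumes "z \<noteq> 0" "t \<noteq> 0"
  defines "A \<equiv> mat2 (w / z\<^sup>2 + \<theta> / (2 * z) + t / 2) (k / z\<^sup>2 + h / z)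
                    (- q / z\<^sup>2 + 1 / z) (- (w / z\<^sup>2 + \<theta> / (2 * z) + t / 2))"
    and "B \<equiv> mat2 (z / 2 + q + \<theta> / (2 * t) - w / t / z) (h / t - k / t / z)
                    (1 / t + q / t / z) (- (z / 2 + q + \<theta> / (2 * t) - w / t / z))"
    and "A' \<equiv> mat2 (w' / z\<^sup>2 + 1 / 2) (k' / z\<^sup>2 + h' / z) (- q' / z\<^sup>2) (- (w' / z\<^sup>2 + 1 / 2))"
    and "B' \<equiv> mat2 (1 / 2 + w / t / z\<^sup>2) (k / t / z\<^sup>2) (- (q / t / z\<^sup>2)) (- (1 / 2 + w / t / z\<^sup>2))"
  shows "A' = B' + A ** B - B ** A \<longleftrightarrow>
    w' = (w + 2 * k + 2 * q * h) / t
    \<and> q' = (q + 4 * w) / t + 2 * q\<^sup>2 + 2 * \<theta> * q / t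
    \<and> k' / z\<^sup>2 + h' / z = (k / t + 4 * w * h / t - 2 * k * q - 2 * \<theta> * k / t) / z\<^sup>2 - (2 * k + 2 * h * q) / z"
proof -
  have c11: "(k / z\<^sup>2 + h / z) * (1 / t + q / t / z) - (- q / z\<^sup>2 + 1 / z) * (h / t - k / t / z)
      = (2 * k + 2 * q * h) / t / z\<^sup>2"
    using assms(1,2) by (simp add: field_simps power2_eq_square)
  have c12: "2 * ((w / z\<^sup>2 + \<theta> / (2 * z) + t / 2) * (h / t - k / t / z)
        - (k / z\<^sup>2 + h / z) * (z / 2 + q + \<theta> / (2 * t) - w / t / z))
      = (4 * w * h / t - 2 * k * q - 2 * \<theta> * k / t) / z\<^sup>2 - (2 * k + 2 * h * q) / z"
    using assms(1,2) by (simp add: field_simps power2_eq_square)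
  have c21: "2 * ((- q / z\<^sup>2 + 1 / z) * (z / 2 + q + \<theta> / (2 * t) - w / t / z)
        - (w / z\<^sup>2 + \<theta> / (2 * z) + t / 2) * (1 / t + q / t / z))
      = - (4 * w / t + 2 * q\<^sup>2 + 2 * \<theta> * q / t) / z\<^sup>2"
    using assms(1,2) by (simp add: field_simps power2_eq_square)
  have *: "A ** B - B ** A = mat2 ((2 * k + 2 * q * h) / t / z\<^sup>2)
      ((4 * w * h / t - 2 * k * q - 2 * \<theta> * k / t) / z\<^sup>2 - (2 * k + 2 * h * q) / z)
      (- (4 * w / t + 2 * q\<^sup>2 + 2 * \<theta> * q / t) / z\<^sup>2) (- ((2 * k + 2 * q * h) / t / z\<^sup>2))"
    unfolding A_def B_def mat2_commutator c11 c12 c21 ..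
  \<comment> \<open>The two summands 1/2, from \<open>t / 2\<close> in \<open>A\<close> and
    \<open>z / 2\<close> in \<open>B\<close>, cancel.\<close>
  have e11: "w' / z\<^sup>2 + 1 / 2 = 1 / 2 + w / t / z\<^sup>2 + (2 * k + 2 * q * h) / t / z\<^sup>2
      \<longleftrightarrow> w' = (w + 2 * k + 2 * q * h) / t"
    using assms(1) by (simp add: add_divide_distrib flip: divide_add_eq_iff) (simp add: field_simps)
  have e12: "k / t / z\<^sup>2
        + ((4 * w * h / t - 2 * k * q - 2 * \<theta> * k / t) / z\<^sup>2 - (2 * k + 2 * h * q) / z)
      = (k / t + 4 * w * h / t - 2 * k * q - 2 * \<theta> * k / t) / z\<^sup>2 - (2 * k + 2 * h * q) / z"
    by (simp add: add_divide_distrib diff_divide_distrib)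
  have e21: "- q' / z\<^sup>2 = - (q / t / z\<^sup>2) + - (4 * w / t + 2 * q\<^sup>2 + 2 * \<theta> * q / t) / z\<^sup>2
      \<longleftrightarrow> q' = (q + 4 * w) / t + 2 * q\<^sup>2 + 2 * \<theta> * q / t"
  proof -
    have "- (q / t / z\<^sup>2) + - (4 * w / t + 2 * q\<^sup>2 + 2 * \<theta> * q / t) / z\<^sup>2
        = - ((q + 4 * w) / t + 2 * q\<^sup>2 + 2 * \<theta> * q / t) / z\<^sup>2"
      by (simp add: add_divide_distrib diff_divide_distrib)
    moreover have "- q' / z\<^sup>2 = - R / z\<^sup>2 \<longleftrightarrow> q' = R" for R using assms(1) by simp
    ultimately show ?thesis by metis
  qed
  have "A' = B' + A ** B - B ** A \<longleftrightarrow> A' = B' + (A ** B - B ** A)"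
    by (simp add: add_diff_eq)
  then show ?thesis
    unfolding * unfolding A'_def B'_def mat2_add mat2_eq_iff e12 e21 using e11 by auto
qed

section \<open>Algebraic relations among the coefficients and the flow they imply\<close>

text \<open>Equivalently, \<open>PIII_A0\<close> has determinant -t^2/4, so its eigenvalues are t/2
  and -t/2.\<close>

lemma PIII_k_relation: "q \<noteq> 0 \<Longrightarrow> 4 * q * PIII_k \<theta>i p q t = 4 * (PIII_w \<theta>i p q t)\<^sup>2 - t\<^sup>2"
  by (simp add: PIII_k_def)

text \<open>Equivalently, the product of \<open>PIII_A0\<close> and \<open>PIII_A1\<close> has trace
  t \<theta>0 / 2. This is how the parameter \<theta>0 enters the connection.\<close>

lemma PIII_h_relation:
  "q \<noteq> 0 \<Longrightarrow>
     2 * q * PIII_h \<theta>0 \<theta>i p q t = 2 * PIII_k \<theta>i p q t + 2 * PIII_w \<theta>i p q t * \<theta>i - t * \<theta>0"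
  by (simp add: PIII_h_def PIII_k_def PIII_w_def power2_eq_square power4_eq_xxxx field_simps)

text \<open>Here \<open>w'\<close> is the derivative of \<open>w\<close> written out by the chain
  rule. Since 4w = 4p - 2tq^2 - 2 \<open>\<theta>i\<close> q, the right side of the
  \<open>q'\<close> equation collapses to \<open>PIII_rhs_q\<close>. Once \<open>q'\<close> is
  known, \<open>w'\<close> is \<open>p'\<close> plus known terms, so its equation determines
  \<open>p'\<close>.\<close>

lemma PIII_system_in_w_iff:
  fixes \<theta>0 \<theta>i p q t p' q' :: complex
  assumes "q \<noteq> 0" "t \<noteq> 0"
  defines "w \<equiv> PIII_w \<theta>i p q t" and "k \<equiv> PIII_k \<theta>i p q t" and "h \<equiv> PIII_h \<theta>0 \<theta>i p q t"
    and "w' \<equiv> (1/2) * (- (q\<^sup>2 + 2 * t * q * q') - \<theta>i * q' + 2 * p')"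
  shows "w' = (w + 2 * k + 2 * q * h) / t \<and> q' = (q + 4 * w) / t + 2 * q\<^sup>2 + 2 * \<theta>i * q / t
     \<longleftrightarrow> q' = PIII_rhs_q p q t \<and> p' = PIII_rhs_p \<theta>0 \<theta>i p q t"
proof -
  have "(q + 4 * w) / t + 2 * q\<^sup>2 + 2 * \<theta>i * q / t = PIII_rhs_q p q t"
    using assms(1,2) by (simp add: w_def PIII_w_def PIII_rhs_q_def field_simps power2_eq_square)
  moreover have "w' = (w + 2 * k + 2 * q * h) / t \<longleftrightarrow> p' = PIII_rhs_p \<theta>0 \<theta>i p q t"
    if q': "q' = PIII_rhs_q p q t"
  proof -
    have "(w + 2 * k + 2 * q * h) / t = (w + 4 * k + 2 * w * \<theta>i - t * \<theta>0) / t"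
      using PIII_h_relation[OF assms(1)] by (simp add: w_def k_def h_def)
    moreover have "w' - (w + 4 * k + 2 * w * \<theta>i - t * \<theta>0) / t = p' - PIII_rhs_p \<theta>0 \<theta>i p q t"
      using assms(1,2) by (simp add: q' w'_def k_def w_def PIII_k_def PIII_w_def PIII_rhs_p_def
          PIII_rhs_q_def field_simps power2_eq_square power3_eq_cube)
    ultimately show ?thesis by (metis eq_iff_diff_eq_0)
  qed
  ultimately show ?thesis by auto
qed

text \<open>The relations for \<open>k\<close> and \<open>h\<close> and their differentiated forms
  are linear in \<open>k'\<close> and \<open>h'\<close> with nonzero leading coefficient, so the
  flow of \<open>w\<close> and \<open>q\<close> determines both derivatives. Multiplying by
  \<open>t\<close> makes everything polynomial.\<close>

lemma PIII_offdiag_flow: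
  fixes w k h q t \<theta> \<theta>0 w' k' h' q' :: complex
  assumes "q \<noteq> 0" "t \<noteq> 0"
    and k: "4 * q * k = 4 * w\<^sup>2 - t\<^sup>2" and h: "2 * q * h = 2 * k + 2 * w * \<theta> - t * \<theta>0"
    and k': "4 * (q' * k + q * k') = 8 * w * w' - 2 * t"
    and h': "2 * (q' * h + q * h') = 2 * k' + 2 * w' * \<theta> - \<theta>0"
    and w': "w' = (w + 2 * k + 2 * q * h) / t"
    and q': "q' = (q + 4 * w) / t + 2 * q\<^sup>2 + 2 * \<theta> * q / t"
  shows "k' = k / t + 4 * w * h / t - 2 * k * q - 2 * \<theta> * k / t" and "h' = - (2 * k + 2 * h * q)"
proof -
  have tw': "t * w' = w + 2 * k + 2 * q * h"
    and tq': "t * q' = q + 4 * w + 2 * t * q\<^sup>2 + 2 * \<theta> * q"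
    using assms(2) by (simp_all add: w' q' field_simps)
  \<comment> \<open>Substituting the flow into \<open>k'\<close>, the terms 16wk cancel and 8w^2 -
    2t^2 becomes 8qk by the relation \<open>k\<close>.\<close>
  have "4 * q * (t * k' - (k + 4 * w * h - 2 * t * k * q - 2 * \<theta> * k)) = 0"
    using k k' tw' tq' by algebra
  then have tk': "t * k' = k + 4 * w * h - 2 * t * k * q - 2 * \<theta> * k"
    using assms(1) by simp
  have "k' = t * k' / t" using assms(2) by simp
  then show "k' = k / t + 4 * w * h / t - 2 * k * q - 2 * \<theta> * k / t"
    using assms(2) by (simp add: tk' add_divide_distrib diff_divide_distrib)
  \<comment> \<open>The undifferentiated relation \<open>h\<close> serves to eliminate
    \<theta>0.\<close>
  have "2 * q * (t * (h' + (2 * k + 2 * h * q))) = 0"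
    using h h' tw' tq' tk' by algebra
  then have "h' + (2 * k + 2 * h * q) = 0" using assms(1,2) by simp
  then show "h' = - (2 * k + 2 * h * q)" using eq_neg_iff_add_eq_0 by blast
qed

section \<open>Derivatives of the coefficients and the commutation criterion\<close>

text \<open>The quotient formulas give only the differentiability of \<open>k\<close> and
  \<open>h\<close>. Their derivatives are recorded implicitly, by differentiating polynomial
  relations whose two sides agree on the open set \<open>U\<close>; this is the form that
  \<open>PIII_offdiag_flow\<close> consumes.\<close>

lemma PIII_coefficient_derivs:
  fixes \<theta>0 \<theta>i :: complex and U :: "complex set" and p q :: "complex \<Rightarrow> complex"
  assumes "open U" "p holomorphic_on U" "q holomorphic_on U" "\<forall>t\<in>U. q t \<noteq> 0" and t: "t \<in> U"
    and w_def: "w = (\<lambda>s. PIII_w \<theta>i (p s) (q s) s)" and k_def: "k = (\<lambda>s. PIII_k \<theta>i (p s) (q s) s)"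
    and h_def: "h = (\<lambda>s. PIII_h \<theta>0 \<theta>i (p s) (q s) s)"
  shows "(w has_field_derivative deriv w t) (at t)" "(k has_field_derivative deriv k t) (at t)"
    "(h has_field_derivative deriv h t) (at t)"
    and "deriv w t = (1/2) * (- ((q t)\<^sup>2 + 2 * t * q t * deriv q t) - \<theta>i * deriv q t + 2 * deriv p t)"
    and "4 * (deriv q t * k t + q t * deriv k t) = 8 * w t * deriv w t - 2 * t"
    and "2 * (deriv q t * h t + q t * deriv h t) = 2 * deriv k t + 2 * deriv w t * \<theta>i - \<theta>0"
proof -
  have p: "(p has_field_derivative deriv p t) (at t)" and q: "(q has_field_derivative deriv q t) (at t)"
    using assms holomorphic_derivI by blast+
  have qt: "q t \<noteq> 0" using assms by blast
  have "(w has_field_derivative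
      (1/2) * (- ((q t)\<^sup>2 + 2 * t * q t * deriv q t) - \<theta>i * deriv q t + 2 * deriv p t)) (at t)"
    unfolding w_def PIII_w_def
    by (auto intro!: derivative_eq_intros p q simp: power2_eq_square algebra_simps)
  then show w': "deriv w t = (1/2) * (- ((q t)\<^sup>2 + 2 * t * q t * deriv q t) - \<theta>i * deriv q t + 2 * deriv p t)"
    and w: "(w has_field_derivative deriv w t) (at t)"
    by (simp_all add: DERIV_imp_deriv)
  have pq_diff: "p field_differentiable at t" "q field_differentiable at t" "w field_differentiable at t"
    using p q w field_differentiable_def by blast+
  have "k = (\<lambda>s. (4 * (w s)\<^sup>2 - s\<^sup>2) / (4 * q s))"
    by (simp add: k_def w_def PIII_k_def)
  then have "k field_differentiable at t"
    using qt pq_diff by (simp, intro derivative_intros; simp)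
  then show k: "(k has_field_derivative deriv k t) (at t)"
    by (simp add: DERIV_deriv_iff_field_differentiable)
  have "h field_differentiable at t"
    unfolding h_def PIII_h_def using qt pq_diff
    by (intro derivative_intros; simp)
  then show h: "(h has_field_derivative deriv h t) (at t)"
    by (simp add: DERIV_deriv_iff_field_differentiable)
  have "((\<lambda>s. 4 * q s * k s) has_field_derivative 4 * (deriv q t * k t + q t * deriv k t)) (at t)"
    by (auto intro!: derivative_eq_intros q k simp: algebra_simps)
  moreover have "((\<lambda>s. 4 * (w s)\<^sup>2 - s\<^sup>2) has_field_derivative 8 * w t * deriv w t - 2 * t) (at t)"
    by (auto intro!: derivative_eq_intros w simp: algebra_simps)
  then have "((\<lambda>s. 4 * q s * k s) has_field_derivative 8 * w t * deriv w t - 2 * t) (at t)"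
    by (rule has_field_derivative_transform_within_open[OF _ \<open>open U\<close> t])
       (use assms(4) PIII_k_relation in \<open>auto simp: k_def w_def\<close>)
  ultimately show "4 * (deriv q t * k t + q t * deriv k t) = 8 * w t * deriv w t - 2 * t"
    by (rule DERIV_unique)
  have "((\<lambda>s. 2 * q s * h s) has_field_derivative 2 * (deriv q t * h t + q t * deriv h t)) (at t)"
    by (auto intro!: derivative_eq_intros q h simp: algebra_simps)
  moreover have "((\<lambda>s. 2 * k s + 2 * w s * \<theta>i - s * \<theta>0) has_field_derivative
      2 * deriv k t + 2 * deriv w t * \<theta>i - \<theta>0) (at t)"
    by (auto intro!: derivative_eq_intros k w simp: algebra_simps)
  then have "((\<lambda>s. 2 * q s * h s) has_field_derivative
      2 * deriv k t + 2 * deriv w t * \<theta>i - \<theta>0) (at t)"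
    by (rule has_field_derivative_transform_within_open[OF _ \<open>open U\<close> t])
       (use assms(4) PIII_h_relation in \<open>auto simp: h_def k_def w_def\<close>)
  ultimately show "2 * (deriv q t * h t + q t * deriv h t) = 2 * deriv k t + 2 * deriv w t * \<theta>i - \<theta>0"
    by (rule DERIV_unique)
qed

lemma PIII_operators_commute_iff:
  fixes \<theta>0 \<theta>i :: complex and U :: "complex set" and p q :: "complex \<Rightarrow> complex"
  assumes "open U" "U \<subseteq> - {0}" "p holomorphic_on U" "q holomorphic_on U" "\<forall>t\<in>U. q t \<noteq> 0"
  shows "operators_commute_on ((- {0}) \<times> U) (PIII_A \<theta>0 \<theta>i p q) (PIII_B \<theta>0 \<theta>i p q)
     \<longleftrightarrow> PIII_system_on U \<theta>0 \<theta>i p q"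
proof -
  define w k h where "w = (\<lambda>s. PIII_w \<theta>i (p s) (q s) s)" and "k = (\<lambda>s. PIII_k \<theta>i (p s) (q s) s)"
    and "h = (\<lambda>s. PIII_h \<theta>0 \<theta>i (p s) (q s) s)"
  note derivs = PIII_coefficient_derivs[OF assms(1,3,4,5) _ w_def k_def h_def]
  have q': "(q has_field_derivative deriv q t) (at t)" if "t \<in> U" for t
    using assms(1,4) that holomorphic_derivI by blast
  define A' where "A' = (\<lambda>z t. mat2 (deriv w t / z\<^sup>2 + 1 / 2) (deriv k t / z\<^sup>2 + deriv h t / z)
      (- deriv q t / z\<^sup>2) (- (deriv w t / z\<^sup>2 + 1 / 2)))"
  define B' where "B' = (\<lambda>z t. mat2 (1 / 2 + w t / t / z\<^sup>2) (k t / t / z\<^sup>2)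
      (- (q t / t / z\<^sup>2)) (- (1 / 2 + w t / t / z\<^sup>2)))"
  have A: "PIII_A \<theta>0 \<theta>i p q = (\<lambda>z t. mat2 (w t / z\<^sup>2 + \<theta>i / (2 * z) + t / 2) (k t / z\<^sup>2 + h t / z)
              (- q t / z\<^sup>2 + 1 / z) (- (w t / z\<^sup>2 + \<theta>i / (2 * z) + t / 2)))"
    by (intro ext) (simp add: PIII_A_eq w_def k_def h_def Let_def)
  have B: "PIII_B \<theta>0 \<theta>i p q = (\<lambda>z t. mat2 (z / 2 + q t + \<theta>i / (2 * t) - w t / t / z) (h t / t - k t / t / z)
              (1 / t + q t / t / z) (- (z / 2 + q t + \<theta>i / (2 * t) - w t / t / z)))"
    by (intro ext) (simp add: PIII_B_eq w_def k_def h_def Let_def)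
  have "\<forall>i j. ((\<lambda>s. PIII_A \<theta>0 \<theta>i p q z s $ i $ j) has_field_derivative A' z t $ i $ j) (at t)"
    if "z \<noteq> 0" "t \<in> U" for z t
  proof -
    \<comment> \<open>With \<open>z\<close> fixed, \<open>c\<close> stands for the entries' terms
      constant in \<open>s\<close>, namely \<open>\<theta>i / (2 * z)\<close> and
      \<open>1 / z\<close>.\<close>
    have "((\<lambda>s. w s / z\<^sup>2 + c + s / 2) has_field_derivative deriv w t / z\<^sup>2 + 1 / 2) (at t)"
      "((\<lambda>s. k s / z\<^sup>2 + h s / z) has_field_derivative deriv k t / z\<^sup>2 + deriv h t / z) (at t)"
      "((\<lambda>s. - q s / z\<^sup>2 + c) has_field_derivative - deriv q t / z\<^sup>2) (at t)" for c
      using DERIV_add[OF DERIV_add[OF DERIV_cdivide[OF derivs(1)] DERIV_const] DERIV_cdivide[OF DERIV_ident]]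
        DERIV_add[OF DERIV_cdivide[OF derivs(2)] DERIV_cdivide[OF derivs(3)]]
        DERIV_add[OF DERIV_cdivide[OF DERIV_minus[OF q']] DERIV_const] that by simp_all
    then show ?thesis
      unfolding A A'_def forall_2 mat2_nth by (intro conjI DERIV_minus)
  qed
  moreover have "\<forall>i j. ((\<lambda>x. PIII_B \<theta>0 \<theta>i p q x t $ i $ j) has_field_derivative B' z t $ i $ j) (at z)"
    if "z \<noteq> 0" "t \<in> U" for z t
  proof -
    have "((\<lambda>x. x / 2 + a + b - c / x) has_field_derivative 1 / 2 + c / z\<^sup>2) (at z)"
      "((\<lambda>x. a - c / x) has_field_derivative c / z\<^sup>2) (at z)"
      "((\<lambda>x. a + c / x) has_field_derivative - (c / z\<^sup>2)) (at z)" for a b c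
      using that by (auto intro!: derivative_eq_intros simp: power2_eq_square)
    then show ?thesis
      unfolding B B'_def forall_2 mat2_nth by (intro conjI DERIV_minus)
  qed
  ultimately have "operators_commute_on ((- {0}) \<times> U) (PIII_A \<theta>0 \<theta>i p q) (PIII_B \<theta>0 \<theta>i p q) \<longleftrightarrow>
      (\<forall>(z, t) \<in> (- {0}) \<times> U. A' z t = B' z t + PIII_A \<theta>0 \<theta>i p q z t ** PIII_B \<theta>0 \<theta>i p q z t
          - PIII_B \<theta>0 \<theta>i p q z t ** PIII_A \<theta>0 \<theta>i p q z t)"
    using \<open>open U\<close> by (intro operators_commute_on_iff_zero_curvature open_Times) auto
  also have "\<dots> \<longleftrightarrow> (\<forall>z\<in>- {0}. \<forall>t\<in>U. deriv w t = (w t + 2 * k t + 2 * q t * h t) / t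
      \<and> deriv q t = (q t + 4 * w t) / t + 2 * (q t)\<^sup>2 + 2 * \<theta>i * q t / t
      \<and> deriv k t / z\<^sup>2 + deriv h t / z
        = (k t / t + 4 * w t * h t / t - 2 * k t * q t - 2 * \<theta>i * k t / t) / z\<^sup>2 - (2 * k t + 2 * h t * q t) / z)"
  proof -
    have "A' z t = B' z t + PIII_A \<theta>0 \<theta>i p q z t ** PIII_B \<theta>0 \<theta>i p q z t
          - PIII_B \<theta>0 \<theta>i p q z t ** PIII_A \<theta>0 \<theta>i p q z t \<longleftrightarrow>
        deriv w t = (w t + 2 * k t + 2 * q t * h t) / t
      \<and> deriv q t = (q t + 4 * w t) / t + 2 * (q t)\<^sup>2 + 2 * \<theta>i * q t / t
      \<and> deriv k t / z\<^sup>2 + deriv h t / z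
        = (k t / t + 4 * w t * h t / t - 2 * k t * q t - 2 * \<theta>i * k t / t) / z\<^sup>2 - (2 * k t + 2 * h t * q t) / z"
      if "z \<in> - {0}" "t \<in> U" for z t
      unfolding A B A'_def B'_def using that assms(2) by (intro zero_curvature_mat2_iff) auto
    then show ?thesis by simp
  qed
  also have "\<dots> \<longleftrightarrow> (\<forall>t\<in>U. deriv w t = (w t + 2 * k t + 2 * q t * h t) / t
      \<and> deriv q t = (q t + 4 * w t) / t + 2 * (q t)\<^sup>2 + 2 * \<theta>i * q t / t)" (is "_ \<longleftrightarrow> (\<forall>t\<in>U. ?flow t)")
  proof -
    have "deriv k t / z\<^sup>2 + deriv h t / z
        = (k t / t + 4 * w t * h t / t - 2 * k t * q t - 2 * \<theta>i * k t / t) / z\<^sup>2 - (2 * k t + 2 * h t * q t) / z"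
      if t: "t \<in> U" and flow: "?flow t" for z t
    proof -
      have "q t \<noteq> 0" "t \<noteq> 0" using assms(2,5) t by auto
      have "4 * q t * k t = 4 * (w t)\<^sup>2 - t\<^sup>2"
        "2 * q t * h t = 2 * k t + 2 * w t * \<theta>i - t * \<theta>0"
        using PIII_k_relation PIII_h_relation \<open>q t \<noteq> 0\<close> by (simp_all add: w_def k_def h_def)
      note off = PIII_offdiag_flow[OF \<open>q t \<noteq> 0\<close> \<open>t \<noteq> 0\<close> this
          derivs(5,6)[OF t] conjunct1[OF flow] conjunct2[OF flow]]
      show ?thesis unfolding off by (simp add: add_divide_distrib diff_divide_distrib)
    qed
    note offdiag = this
    show ?thesis (is "(\<forall>z\<in>- {0}. \<forall>t\<in>U. ?P z t) \<longleftrightarrow> _")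
    proof (intro iffI ballI)
      fix t assume "\<forall>z\<in>- {0}. \<forall>t\<in>U. ?P z t" "t \<in> U"
      \<comment> \<open>The flow equations do not involve \<open>z\<close>, so any nonzero value
        serves to extract them.\<close>
      then have "?P 1 t" by (metis ComplI singletonD one_neq_zero)
      then show "?flow t" by simp
    next
      fix z t assume "\<forall>t\<in>U. ?flow t" "t \<in> U"
      then show "?P z t" using offdiag by simp
    qed
  qed
  also have "\<dots> \<longleftrightarrow> PIII_system_on U \<theta>0 \<theta>i p q"
    unfolding PIII_system_on_def
  proof (rule ball_cong[OF refl])
    fix t assume t: "t \<in> U"
    then have "q t \<noteq> 0" "t \<noteq> 0" using assms(2,5) by auto
    then show "?flow t \<longleftrightarrow> deriv q t = PIII_rhs_q (p t) (q t) t \<and> deriv p t = PIII_rhs_p \<theta>0 \<theta>i (p t) (q t) t"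
      unfolding derivs(4)[OF t] unfolding w_def k_def h_def by (rule PIII_system_in_w_iff)
  qed
  finally show ?thesis .
qed

section \<open>Hamiltonian form and the second-order equation\<close>

text \<open>The factor \<open>y\<^sup>2\<close> reflects a non-canonical symplectic form: up to sign
  it is dp dq / q^2.\<close>

lemma PIII_rhs_hamiltonian:
  assumes "y \<noteq> 0" "s \<noteq> 0"
  shows "PIII_rhs_q x y s = - (y\<^sup>2) * deriv (\<lambda>x'. PIII_H \<theta>0 \<theta>i x' y s) x"
    and "PIII_rhs_p \<theta>0 \<theta>i x y s = y\<^sup>2 * deriv (\<lambda>y'. PIII_H \<theta>0 \<theta>i x y' s) y"
proof -
  have "((\<lambda>x'. PIII_H \<theta>0 \<theta>i x' y s) has_field_derivative - (4 * x / (y\<^sup>2 * s)) - 1 / (y * s)) (at x)"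
    unfolding PIII_H_def using assms by (auto intro!: derivative_eq_intros simp: field_simps)
  then have dx: "deriv (\<lambda>x'. PIII_H \<theta>0 \<theta>i x' y s) x = - (4 * x / (y\<^sup>2 * s)) - 1 / (y * s)"
    by (rule DERIV_imp_deriv)
  show "PIII_rhs_q x y s = - (y\<^sup>2) * deriv (\<lambda>x'. PIII_H \<theta>0 \<theta>i x' y s) x"
    unfolding dx using assms by (simp add: PIII_rhs_q_def field_simps power2_eq_square)
  have "((\<lambda>y'. PIII_H \<theta>0 \<theta>i x y' s) has_field_derivative
      4 * x\<^sup>2 / (y ^ 3 * s) + x / (y\<^sup>2 * s) + 1 + y * s - s / y ^ 3 - \<theta>0 / y\<^sup>2 + \<theta>i) (at y)"
    unfolding PIII_H_def using assms
    by (auto intro!: derivative_eq_intros simp: field_simps power2_eq_square power3_eq_cube)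
  then have dy: "deriv (\<lambda>y'. PIII_H \<theta>0 \<theta>i x y' s) y =
      4 * x\<^sup>2 / (y ^ 3 * s) + x / (y\<^sup>2 * s) + 1 + y * s - s / y ^ 3 - \<theta>0 / y\<^sup>2 + \<theta>i"
    by (rule DERIV_imp_deriv)
  show "PIII_rhs_p \<theta>0 \<theta>i x y s = y\<^sup>2 * deriv (\<lambda>y'. PIII_H \<theta>0 \<theta>i x y' s) y"
    unfolding dy using assms by (simp add: PIII_rhs_p_def field_simps power2_eq_square power3_eq_cube)
qed

text \<open>The first equation can be solved for \<open>p\<close>, since t is nonzero on
  \<open>U\<close>. With this \<open>p\<close>, the second equation is the second-order equation
  multiplied by t/4.\<close>

lemma PIII_system_iff_equation:
  fixes \<theta>0 \<theta>i :: complex and U :: "complex set" and p q :: "complex \<Rightarrow> complex"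
  assumes "open U" "U \<subseteq> - {0}" "p holomorphic_on U" "q holomorphic_on U" "\<forall>t\<in>U. q t \<noteq> 0"
  shows "PIII_system_on U \<theta>0 \<theta>i p q \<longleftrightarrow>
     (\<forall>t\<in>U. p t = (1/4) * (t * deriv q t - q t)) \<and> PIII_equation_on U \<theta>0 \<theta>i q"
proof -
  have first: "deriv q t = PIII_rhs_q (p t) (q t) t \<longleftrightarrow> p t = (1/4) * (t * deriv q t - q t)"
    if "t \<in> U" for t
  proof -
    have "t \<noteq> 0" using that assms(2) by auto
    then have "deriv q t = PIII_rhs_q (p t) (q t) t \<longleftrightarrow> deriv q t * t = 4 * p t + q t"
      by (simp add: PIII_rhs_q_def nonzero_eq_divide_eq)
    then show ?thesis by (auto simp: algebra_simps)
  qed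
  have second: "deriv p t = PIII_rhs_p \<theta>0 \<theta>i (p t) (q t) t \<longleftrightarrow>
      deriv (deriv q) t =
        (deriv q t)^2 / q t - deriv q t / t - 4 * \<theta>0 / t + 4 * (\<theta>i + 1) * (q t)^2 / t
        + 4 * (q t)^3 - 4 / q t" (is "_ \<longleftrightarrow> _ = ?rhs")
    if p: "\<forall>t\<in>U. p t = (1/4) * (t * deriv q t - q t)" and t: "t \<in> U" for t
  proof -
    have nz: "t \<noteq> 0" "q t \<noteq> 0" using t assms by auto
    have q': "(q has_field_derivative deriv q t) (at t)"
      and q'': "(deriv q has_field_derivative deriv (deriv q) t) (at t)"
      using assms t holomorphic_deriv holomorphic_derivI by blast+
    \<comment> \<open>The two first-order terms \<open>deriv q t\<close> cancel. Carrying the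
      derivative over to \<open>p\<close> needs the formula for \<open>p\<close> on a neighbourhood
      of t, hence its assumption on all of \<open>U\<close>.\<close>
    have "((\<lambda>t. (1/4) * (t * deriv q t - q t)) has_field_derivative t * deriv (deriv q) t / 4) (at t)"
      by (auto intro!: derivative_eq_intros q' q'')
    then have "(p has_field_derivative t * deriv (deriv q) t / 4) (at t)"
      by (rule has_field_derivative_transform_within_open[OF _ \<open>open U\<close> t]) (use p in auto)
    then have p': "deriv p t = t * deriv (deriv q) t / 4" by (rule DERIV_imp_deriv)
    have rhs: "PIII_rhs_p \<theta>0 \<theta>i (p t) (q t) t = t * ?rhs / 4"
      using nz by (simp add: PIII_rhs_p_def p[rule_format, OF t] field_simps power2_eq_square power3_eq_cube)
    have "t * x / 4 = t * y / 4 \<longleftrightarrow> x = y" for x y using nz by simp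
    then show ?thesis unfolding p' rhs .
  qed
  show ?thesis
    unfolding PIII_system_on_def PIII_equation_on_def using first second by metis
qed

theorem mainTheorem13:
  fixes \<theta>0 \<theta>i :: complex and U :: "complex set" and p q :: "complex \<Rightarrow> complex"
  assumes "open U" and "connected U" and "U \<subseteq> - {0}"
    and "p holomorphic_on U" and "q holomorphic_on U" and "\<forall>t\<in>U. q t \<noteq> 0"
  shows "(operators_commute_on ((- {0}) \<times> U) (PIII_A \<theta>0 \<theta>i p q) (PIII_B \<theta>0 \<theta>i p q)
            \<longleftrightarrow> PIII_system_on U \<theta>0 \<theta>i p q)
       \<and> (\<forall>x y s. y \<noteq> 0 \<and> s \<noteq> 0 \<longrightarrow>
            PIII_rhs_q x y s = - (y^2) * deriv (\<lambda>x'. PIII_H \<theta>0 \<theta>i x' y s) x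
          \<and> PIII_rhs_p \<theta>0 \<theta>i x y s = y^2 * deriv (\<lambda>y'. PIII_H \<theta>0 \<theta>i x y' s) y)
       \<and> (PIII_system_on U \<theta>0 \<theta>i p q \<longleftrightarrow> PIII_hamiltonian_system_on U \<theta>0 \<theta>i p q)
       \<and> (PIII_system_on U \<theta>0 \<theta>i p q \<longleftrightarrow>
            (\<forall>t\<in>U. p t = (1/4) * (t * deriv q t - q t)) \<and> PIII_equation_on U \<theta>0 \<theta>i q)"
proof (intro conjI allI impI)
  show "operators_commute_on ((- {0}) \<times> U) (PIII_A \<theta>0 \<theta>i p q) (PIII_B \<theta>0 \<theta>i p q)
      \<longleftrightarrow> PIII_system_on U \<theta>0 \<theta>i p q"
    using assms by (intro PIII_operators_commute_iff) auto
  show "PIII_system_on U \<theta>0 \<theta>i p q \<longleftrightarrow>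
      (\<forall>t\<in>U. p t = (1/4) * (t * deriv q t - q t)) \<and> PIII_equation_on U \<theta>0 \<theta>i q"
    using assms by (intro PIII_system_iff_equation) auto
  show "PIII_system_on U \<theta>0 \<theta>i p q \<longleftrightarrow> PIII_hamiltonian_system_on U \<theta>0 \<theta>i p q"
    unfolding PIII_system_on_def PIII_hamiltonian_system_on_def
  proof (rule ball_cong[OF refl])
    fix t assume "t \<in> U"
    then have nz: "q t \<noteq> 0" "t \<noteq> 0" using assms(3,6) by auto
    show "deriv q t = PIII_rhs_q (p t) (q t) t \<and> deriv p t = PIII_rhs_p \<theta>0 \<theta>i (p t) (q t) t \<longleftrightarrow>
        deriv q t = - ((q t)^2) * deriv (\<lambda>x. PIII_H \<theta>0 \<theta>i x (q t) t) (p t)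
          \<and> deriv p t = (q t)^2 * deriv (\<lambda>y. PIII_H \<theta>0 \<theta>i (p t) y t) (q t)"
      using PIII_rhs_hamiltonian(1)[OF nz, of "p t" \<theta>0 \<theta>i]
        PIII_rhs_hamiltonian(2)[OF nz, of \<theta>0 \<theta>i "p t"] by simp
  qed
qed (use PIII_rhs_hamiltonian in auto)

end
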